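(* Let $n\ge1$ and let $\alpha,\beta_1,\dots,\beta_n,\gamma_1,\dots,\gamma_n\in\widehat{\kappa^\times}$. Suppose that $\overline{\alpha}\gamma_1\cdots\gamma_n\neq\varepsilon$ and $\beta_i\neq\varepsilon$ for all $i$. Then, for all $\lambda_1,\dots,\lambda_n\in\kappa^\times$, $$(-1)^n\frac{\Big(\prod_{i=1}^n g(\overline{\gamma_i})\Big)g(\overline{\alpha}\gamma_1\cdots\gamma_n)}{g^\circ(\overline{\alpha})}\,F_A^{(n)}\left({\alpha;\beta_1,\dots,\beta_n\atop\gamma_1,\dots,\gamma_n};\lambda_1,\dots,\lambda_n\right)$$ $$=\sum_{u_1,\dots,u_n\in\kappa^\times}\Big(\prod_{i=1}^n\overline{\beta_i}\Big(1-\frac{\lambda_i}{u_i}\Big)\Big)\Big(\prod_{i=1}^n\overline{\gamma_i}(u_i)\Big)\overline{\alpha}\gamma_1\cdots\gamma_n\Big(1-\sum_{i=1}^nu_i\Big).$$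
   Context: $\kappa$ is a finite field with $q$ elements of characteristic $p$. $\widehat{\kappa^\times}=\mathrm{Hom}(\kappa^\times,\overline{\mathbb{Q}}^\times)$ is the group of multiplicative characters, $\varepsilon$ the trivial character, $\overline{\eta}=\eta^{-1}$; every $\eta\in\widehat{\kappa^\times}$ (including $\varepsilon$) is extended to $\kappa$ by $\eta(0)=0$. A product of characters followed by an argument means the product character evaluated there. $\delta(\eta)=1$ if $\eta=\varepsilon$ and $0$ otherwise. Fix a non-trivial additive character $\psi\in\mathrm{Hom}(\kappa,\overline{\mathbb{Q}}^\times)$. Put $$g(\eta)=-\sum_{x\in\kappa^\times}\psi(x)\eta(x),\quad g^\circ(\eta)=q^{\delta(\eta)}g(\eta),\quad(\alpha)_\nu=\frac{g(\alpha\nu)}{g(\alpha)},\quad(\alpha)_\nu^\circ=\frac{g^\circ(\alpha\nu)}{g^\circ(\alpha)}.$$ For $\lambda_i\in\kappa$, $$F_A^{(n)}\left({\alpha;\beta_1,\dots,\beta_n\atop\gamma_1,\dots,\gamma_n};\lambda_1,\dots,\lambda_n\right)=\frac{1}{(1-q)^n}\sum_{\nu_1,\dots,\nu_n\in\widehat{\kappa^\times}}\frac{(\alpha)_{\nu_1\cdots\nu_n}(\beta_1)_{\nu_1}\cdots(\beta_n)_{\nu_n}}{(\gamma_1)^\circ_{\nu_1}\cdots(\gamma_n)^\circ_{\nu_n}(\varepsilon)^\circ_{\nu_1}\cdots(\varepsilon)^\circ_{\nu_n}}\nu_1(\lambda_1)\cdots\nu_n(\lambda_n).$$ *)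

theory Defs
  imports
    "HOL-Algebra.Algebraic_Closure_Type"
    "HOL-Computational_Algebra.Primes"
    "HOL-Library.Cardinality"
    "HOL-Library.FuncSet"
    "HOL-Library.Function_Algebras"
    "HOL-Library.Function_Division"
begin

type_synonym qbar = "rat alg_closure"

text \<open>
  A character of the multiplicative group of \<open>'k\<close> is represented by its extension by zero to all
  of \<open>'k\<close>. Products and inverses of characters are then the pointwise ones (\<open>inverse 0 = 0\<close>), as
  provided by the instances for function types. The unit \<open>1\<close> of the function type is not a
  character, since it does not vanish at \<open>0\<close>; the trivial character is \<open>triv_char\<close>, and it is not
  the value of an empty product of functions.
\<close>

definition mult_chars :: "('k::finite_field \<Rightarrow> qbar) set" where
  "mult_chars = {\<eta>. \<eta> 0 = 0 \<and> (\<forall>x. x \<noteq> 0 \<longrightarrow> \<eta> x \<noteq> 0) \<and>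
                     (\<forall>x y. x \<noteq> 0 \<longrightarrow> y \<noteq> 0 \<longrightarrow> \<eta> (x * y) = \<eta> x * \<eta> y)}"

definition triv_char :: "'k::finite_field \<Rightarrow> qbar" where
  "triv_char x = (if x = 0 then 0 else 1)"

definition nontrivial_add_char :: "('k::finite_field \<Rightarrow> qbar) \<Rightarrow> bool" where
  "nontrivial_add_char \<psi> \<longleftrightarrow>
     (\<forall>x. \<psi> x \<noteq> 0) \<and> (\<forall>x y. \<psi> (x + y) = \<psi> x * \<psi> y) \<and> (\<exists>x. \<psi> x \<noteq> 1)"

definition char_delta :: "('k::finite_field \<Rightarrow> qbar) \<Rightarrow> nat" where
  "char_delta \<eta> = (if \<eta> = triv_char then 1 else 0)"

definition gauss :: "('k::finite_field \<Rightarrow> qbar) \<Rightarrow> ('k \<Rightarrow> qbar) \<Rightarrow> qbar" where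
  "gauss \<psi> \<eta> = - (\<Sum>x\<in>-{0}. \<psi> x * \<eta> x)"

definition gauss_circ :: "('k::finite_field \<Rightarrow> qbar) \<Rightarrow> ('k \<Rightarrow> qbar) \<Rightarrow> qbar" where
  "gauss_circ \<psi> \<eta> = of_nat CARD('k) ^ char_delta \<eta> * gauss \<psi> \<eta>"

definition poch :: "('k::finite_field \<Rightarrow> qbar) \<Rightarrow> ('k \<Rightarrow> qbar) \<Rightarrow> ('k \<Rightarrow> qbar) \<Rightarrow> qbar" where
  "poch \<psi> \<alpha> \<nu> = gauss \<psi> (\<alpha> * \<nu>) / gauss \<psi> \<alpha>"

definition poch_circ :: "('k::finite_field \<Rightarrow> qbar) \<Rightarrow> ('k \<Rightarrow> qbar) \<Rightarrow> ('k \<Rightarrow> qbar) \<Rightarrow> qbar" where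
  "poch_circ \<psi> \<alpha> \<nu> = gauss_circ \<psi> (\<alpha> * \<nu>) / gauss_circ \<psi> \<alpha>"

definition lauricella_FA ::
  "('k::finite_field \<Rightarrow> qbar) \<Rightarrow> nat \<Rightarrow> ('k \<Rightarrow> qbar) \<Rightarrow> (nat \<Rightarrow> 'k \<Rightarrow> qbar) \<Rightarrow> (nat \<Rightarrow> 'k \<Rightarrow> qbar)
    \<Rightarrow> (nat \<Rightarrow> 'k) \<Rightarrow> qbar" where
  "lauricella_FA \<psi> n \<alpha> \<beta> \<gamma> l =
     1 / (1 - of_nat CARD('k)) ^ n *
     (\<Sum>\<nu> \<in> {1..n} \<rightarrow>\<^sub>E mult_chars.
        (poch \<psi> \<alpha> (\<Prod>i=1..n. \<nu> i) * (\<Prod>i=1..n. poch \<psi> (\<beta> i) (\<nu> i))) /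
        ((\<Prod>i=1..n. poch_circ \<psi> (\<gamma> i) (\<nu> i)) * (\<Prod>i=1..n. poch_circ \<psi> triv_char (\<nu> i))) *
        (\<Prod>i=1..n. \<nu> i (l i)))"

text \<open>
  The index set of the sum in \<^const>\<open>lauricella_FA\<close> is finite, so that sum is not the default
  value \<open>0\<close> of sums over infinite sets.
\<close>

lemma finite_mult_chars: "finite (mult_chars :: ('k::finite_field \<Rightarrow> qbar) set)"
proof -
  define N where "N = CARD('k)"
  have card: "N > 1"
    unfolding N_def by (metis One_nat_def card_1_singleton_iff UNIV_I finite_UNIV_card_ge_0 finite
        less_one linorder_neqE_nat neq0_conv singletonD zero_neq_one)
  define p :: "qbar poly" where "p = monom 1 N - monom 1 1"
  have "coeff p N = 1" using card by (simp add: p_def)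
  then have "p \<noteq> 0" by auto
  then have fin: "finite {z. poly p z = 0}" by (rule poly_roots_finite)
  have "\<eta> x \<in> {z. poly p z = 0}" if \<eta>: "\<eta> \<in> mult_chars" for \<eta> :: "'k \<Rightarrow> qbar" and x
  proof -
    have mult: "\<eta> (a * b) = \<eta> a * \<eta> b" for a b
      using \<eta> by (cases "a = 0"; cases "b = 0") (auto simp: mult_chars_def)
    have "\<eta> (x ^ Suc m) = \<eta> x ^ Suc m" for m
      by (induction m) (auto simp: mult)
    then have "\<eta> (x ^ N) = \<eta> x ^ N"
      using card by (metis Suc_pred' less_trans zero_less_one)
    moreover have "x ^ N = x"
      by (simp add: N_def finite_field_power_card_eq_same)
    ultimately show ?thesis by (simp add: p_def poly_monom)
  qed
  then have "mult_chars \<subseteq> (UNIV :: 'k set) \<rightarrow>\<^sub>E {z. poly p z = 0}"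
    by auto
  with fin show ?thesis
    by (meson finite finite_PiE finite_subset)
qed

end

theory Submission
  imports Defs "HOL-Algebra.Multiplicative_Group"
begin

text \<open>
  The factors \<open>\<beta>\<^sub>i\<inverse>(1 - \<lambda>\<^sub>i/u\<^sub>i)\<close> of the right-hand side are expanded in characters of \<open>\<lambda>\<^sub>i/u\<^sub>i\<close>, which
  leaves Jacobi sums over \<open>u\<close> as coefficients. There are two ingredients.

  The first is a binomial theorem (\<open>binomial_expansion\<close>): for \<open>\<beta> \<noteq> \<epsilon>\<close> and \<open>x \<noteq> 0\<close>, the function
  \<open>x \<mapsto> \<beta>\<inverse>(1 - x)\<close> is \<open>1/(1-q)\<close> times the sum of \<open>((\<beta>)\<^sub>\<nu> / (\<epsilon>)\<degree>\<^sub>\<nu>) \<nu>(x)\<close> over all characters \<open>\<nu>\<close>.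
  This is Fourier inversion on the multiplicative group, the Fourier coefficients being Jacobi
  sums in two characters. Substituting it with \<open>x = \<lambda>\<^sub>i/u\<^sub>i\<close> for every \<open>i\<close> and exchanging the sums,
  the right-hand side becomes a sum over \<open>\<nu>\<^sub>1, \<dots>, \<nu>\<^sub>n\<close> whose inner sum over \<open>u\<close> is the Jacobi sum
  of the characters \<open>(\<gamma>\<^sub>i\<nu>\<^sub>i)\<inverse>\<close> and \<open>\<delta> = \<alpha>\<inverse>\<gamma>\<^sub>1\<cdots>\<gamma>\<^sub>n\<close>.

  The second is the evaluation of a Jacobi sum in \<open>n + 1\<close> characters as a quotient of Gauss sums
  (\<open>jacobi_sum\<close>). As soon as the one distinguished character \<open>\<delta>\<close> is non-trivial, a single formula
  with \<open>g\<degree>\<close> of the product character in the denominator covers both the case of a trivial and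
  that of a non-trivial product. The reflection formula \<open>g(\<eta>) g\<degree>(\<eta>\<inverse>) = q \<eta>(-1)\<close> then turns Gauss
  sums of inverse characters into Pochhammer symbols; the signs \<open>\<nu>\<^sub>i(-1)\<close> that it produces in the
  numerator and in the denominator cancel (\<open>twisted_jacobi_sum\<close>), and the terms of the Lauricella
  series remain.
\<close>

section \<open>Multiplicative characters\<close>

lemma mult_char_zero: "\<eta> \<in> mult_chars \<Longrightarrow> \<eta> 0 = 0"
  and mult_char_nonzero: "\<eta> \<in> mult_chars \<Longrightarrow> x \<noteq> 0 \<Longrightarrow> \<eta> x \<noteq> 0"
  by (auto simp: mult_chars_def)

lemma mult_char_mult: "\<eta> \<in> mult_chars \<Longrightarrow> \<eta> (x * y) = \<eta> x * \<eta> y"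
  by (cases "x = 0"; cases "y = 0") (auto simp: mult_chars_def)

lemma mult_char_one:
  assumes "\<eta> \<in> mult_chars"
  shows "\<eta> 1 = 1"
  using mult_char_mult[OF assms, of 1 1] mult_char_nonzero[OF assms, of 1] by simp

lemma mult_char_inverse:
  assumes "\<eta> \<in> mult_chars"
  shows "\<eta> (inverse x) = inverse (\<eta> x)"
proof (cases "x = 0")
  case True
  then show ?thesis using mult_char_zero[OF assms] by simp
next
  case False
  then have "\<eta> (inverse x) * \<eta> x = 1"
    using mult_char_mult[OF assms, of "inverse x" x] mult_char_one[OF assms] by simp
  then show ?thesis
    using inverse_unique[of "\<eta> x" "\<eta> (inverse x)"] by (simp add: mult.commute)
qed

lemma mult_char_divide: "\<eta> \<in> mult_chars \<Longrightarrow> \<eta> (x / y) = \<eta> x / \<eta> y"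
  by (simp add: divide_inverse mult_char_mult mult_char_inverse)

lemma mult_char_minus_one_square:
  assumes "\<eta> \<in> mult_chars"
  shows "\<eta> (-1) * \<eta> (-1) = 1"
  using mult_char_mult[OF assms, of "-1" "-1"] mult_char_one[OF assms] by simp

lemma triv_char_in_mult_chars: "triv_char \<in> mult_chars"
  by (simp add: mult_chars_def triv_char_def)

lemma mult_chars_times: "\<eta> \<in> mult_chars \<Longrightarrow> \<mu> \<in> mult_chars \<Longrightarrow> \<eta> * \<mu> \<in> mult_chars"
  by (simp add: mult_chars_def)

lemma mult_chars_inverse: "\<eta> \<in> mult_chars \<Longrightarrow> inverse \<eta> \<in> mult_chars"
  by (simp add: mult_chars_def)

lemma inverse_inverse_fun: "inverse (inverse \<eta>) = (\<eta> :: 'k \<Rightarrow> qbar)"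
  by (simp add: fun_eq_iff)

lemma inverse_times_fun: "inverse (\<eta> * \<mu>) = inverse \<eta> * inverse (\<mu> :: 'k \<Rightarrow> qbar)"
  by (simp add: fun_eq_iff)

lemma prod_fun_apply: "(\<Prod>i\<in>I. f i) x = (\<Prod>i\<in>I. f i x :: qbar)"
  by (induction I rule: infinite_finite_induct) auto

lemma inverse_prod_fun: "inverse (\<Prod>i\<in>I. f i) = (\<Prod>i\<in>I. inverse (f i :: 'k \<Rightarrow> qbar))"
  by (simp add: fun_eq_iff prod_fun_apply prod_inversef[symmetric] o_def)

lemma triv_char_times: "\<eta> \<in> mult_chars \<Longrightarrow> triv_char * \<eta> = \<eta>"
  by (auto simp: fun_eq_iff triv_char_def mult_chars_def)

lemma inverse_triv_char: "inverse triv_char = triv_char"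
  by (auto simp: fun_eq_iff triv_char_def)

lemma inverse_eq_triv_char_iff: "inverse \<eta> = triv_char \<longleftrightarrow> \<eta> = triv_char"
  by (metis inverse_inverse_fun inverse_triv_char)

lemma times_inverse_cancel:
  assumes "\<mu> \<in> mult_chars" "\<eta> \<in> mult_chars"
  shows "\<mu> * (inverse \<mu> * \<eta>) = \<eta>"
proof
  fix x
  show "(\<mu> * (inverse \<mu> * \<eta>)) x = \<eta> x"
    using mult_char_zero[OF assms(2)] mult_char_nonzero[OF assms(1), of x] by (cases "x = 0") auto
qed

lemma inverse_times_cancel:
  assumes "\<mu> \<in> mult_chars" "\<eta> \<in> mult_chars"
  shows "inverse \<mu> * (\<mu> * \<eta>) = \<eta>"
  using times_inverse_cancel[OF assms] by (simp only: mult.left_commute)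

lemma mult_chars_times_prod:
  assumes "finite I" "\<eta> \<in> mult_chars" "\<And>i. i \<in> I \<Longrightarrow> \<chi> i \<in> mult_chars"
  shows "\<eta> * (\<Prod>i\<in>I. \<chi> i) \<in> mult_chars"
  using assms
proof (induction I)
  case (insert i I)
  then have "\<chi> i * (\<eta> * (\<Prod>i\<in>I. \<chi> i)) \<in> mult_chars"
    using mult_chars_times by blast
  also have "\<chi> i * (\<eta> * (\<Prod>i\<in>I. \<chi> i)) = \<eta> * (\<Prod>i\<in>insert i I. \<chi> i)"
    using insert.hyps by (metis mult.left_commute prod.insert)
  finally show ?case .
qed simp

lemma mult_chars_prod:
  assumes "finite I" "I \<noteq> {}" "\<And>i. i \<in> I \<Longrightarrow> \<chi> i \<in> mult_chars"
  shows "(\<Prod>i\<in>I. \<chi> i) \<in> mult_chars"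
proof -
  obtain i where i: "i \<in> I" using assms(2) by blast
  have "\<chi> i * (\<Prod>i\<in>I-{i}. \<chi> i) \<in> mult_chars"
    using assms i by (intro mult_chars_times_prod) auto
  then show ?thesis using i assms(1) by (simp add: prod.remove)
qed

section \<open>Orthogonality and Fourier inversion\<close>

lemma of_nat_card_units: "of_nat (card (- {0} :: 'k::finite_field set)) = of_nat CARD('k) - (1 :: qbar)"
proof -
  have "card (- {0} :: 'k set) = CARD('k) - 1"
    by (simp add: Compl_eq_Diff_UNIV)
  moreover have "CARD('k) \<ge> 1" by (simp add: Suc_leI)
  ultimately show ?thesis by (simp add: of_nat_diff)
qed

lemma card_finite_field_ge_2: "CARD('k::finite_field) \<ge> 2"
proof -
  have "card {0, 1 :: 'k} \<le> CARD('k)" by (rule card_mono) auto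
  then show ?thesis by simp
qed

lemma of_nat_card_neq_0: "of_nat CARD('k::finite_field) \<noteq> (0 :: qbar)"
  and of_nat_card_neq_1: "of_nat CARD('k::finite_field) \<noteq> (1 :: qbar)"
proof -
  show "of_nat CARD('k) \<noteq> (0 :: qbar)" by simp
  have "CARD('k) \<noteq> 1" using card_finite_field_ge_2[where 'k='k] by simp
  then show "of_nat CARD('k) \<noteq> (1 :: qbar)" by (metis of_nat_1 of_nat_eq_iff)
qed

lemma sum_nonzero_rescale:
  fixes f :: "'k::finite_field \<Rightarrow> qbar"
  assumes "c \<noteq> 0"
  shows "(\<Sum>x\<in>-{0}. f (c * x)) = (\<Sum>x\<in>-{0}. f x)"
  by (rule sum.reindex_bij_witness[of _ "\<lambda>x. x / c" "\<lambda>x. c * x"]) (use assms in auto)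

lemma sum_mult_char:
  fixes \<eta> :: "'k::finite_field \<Rightarrow> qbar"
  assumes \<eta>: "\<eta> \<in> mult_chars"
  shows "(\<Sum>x\<in>-{0}. \<eta> x) = (if \<eta> = triv_char then of_nat CARD('k) - 1 else 0)"
proof (cases "\<eta> = triv_char")
  case True
  have "(\<Sum>x\<in>-{0::'k}. triv_char x) = (\<Sum>x\<in>-{0::'k}. 1 :: qbar)"
    by (rule sum.cong) (auto simp: triv_char_def)
  then show ?thesis using True by (simp add: of_nat_card_units)
next
  case False
  then obtain c where "\<eta> c \<noteq> triv_char c" by (auto simp: fun_eq_iff)
  then have c: "c \<noteq> 0" "\<eta> c \<noteq> 1"
    using mult_char_zero[OF \<eta>] by (auto simp: triv_char_def split: if_splits)
  have "(\<Sum>x\<in>-{0}. \<eta> x) = \<eta> c * (\<Sum>x\<in>-{0}. \<eta> x)"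
    using sum_nonzero_rescale[OF c(1), of \<eta>] by (simp add: mult_char_mult[OF \<eta>] sum_distrib_left)
  then show ?thesis using False c by (simp add: mult_cancel_right1)
qed

text \<open>
  With \<open>d = gcd N k\<close> and \<open>m = N / d > 1\<close>, a root \<open>\<omega>\<close> of \<open>1 + X + \<dots> + X\<^bsup>m-1\<^esup>\<close> is an \<open>m\<close>-th root of
  unity, different from \<open>1\<close> because the polynomial takes the non-zero value \<open>m\<close> at \<open>1\<close>. Since \<open>k / d\<close>
  is prime to \<open>m\<close>, the power of \<open>\<omega>\<close> with exponent \<open>k / d\<close> is still different from \<open>1\<close>, and any \<open>d\<close>-th root of \<open>\<omega>\<close> serves
  as \<open>\<zeta>\<close>.
\<close>

lemma ex_root_of_unity_power_neq_1:
  assumes N: "N > 0" and k: "\<not> N dvd k"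
  shows "\<exists>\<zeta> :: 'a :: {alg_closed_field, ring_char_0}. \<zeta> ^ N = 1 \<and> \<zeta> ^ k \<noteq> 1"
proof -
  obtain m k' where mk': "N = m * gcd N k" "k = k' * gcd N k" "coprime m k'"
    using gcd_coprime_exists[of N k] N by auto
  define d where "d = gcd N k"
  have d: "d > 0" using N by (simp add: d_def)
  have mk: "N = d * m" "k = d * k'" using mk' by (simp_all add: d_def mult.commute)
  have cop: "gcd k' m = 1" using mk'(3) by (simp add: coprime_iff_gcd_eq_1 gcd.commute)
  have "m \<noteq> 0" "m \<noteq> 1" using N k mk by auto
  then have m: "m > 1" by simp
  obtain \<omega> :: 'a where \<omega>: "(\<Sum>i\<le>m-1. 1 * \<omega> ^ i) = 0"
    using alg_closed[of "m-1" "\<lambda>_. 1"] m by auto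
  have \<omega>m: "\<omega> ^ m = 1"
    using power_diff_1_eq[of \<omega> m] \<omega> m by (simp add: lessThan_Suc_atMost[symmetric])
  have \<omega>1: "\<omega> \<noteq> 1" using \<omega> m by (auto simp flip: of_nat_Suc)
  obtain \<zeta> where \<zeta>: "\<zeta> ^ d = \<omega>" using nth_root_exists[OF d] by blast
  have "\<omega> ^ k' \<noteq> 1"
  proof
    assume *: "\<omega> ^ k' = 1"
    have "k' \<noteq> 0" using cop m by (auto intro: ccontr)
    then obtain x y where xy: "k' * x = m * y + 1" using bezout_nat[of k' m] cop by auto
    have "\<omega> ^ (k' * x) = 1" using * by (simp add: power_mult)
    moreover have "\<omega> ^ (m * y + 1) = \<omega>" using \<omega>m by (simp add: power_mult)
    ultimately show False using xy \<omega>1 by simp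
  qed
  then show ?thesis using \<zeta> \<omega>m by (auto simp: mk power_mult)
qed

lemma ex_generator: "\<exists>a :: 'k::finite_field. a \<noteq> 0 \<and> (\<forall>x. x \<noteq> 0 \<longrightarrow> (\<exists>i. x = a ^ i))"
proof -
  define K where "K = (ring_of_type_algebra :: 'k ring)"
  interpret K: field K unfolding K_def by rule
  have pow: "x [^]\<^bsub>K\<^esub> i = x ^ i" for x and i :: nat
    by (induction i) (auto simp: K_def ring_of_type_algebra_def mult.commute nat_pow_def)
  have c: "carrier K = UNIV" "\<zero>\<^bsub>K\<^esub> = 0" by (auto simp: K_def ring_of_type_algebra_def)
  have "\<exists>a\<in>- {0::'k}. - {0} = {a ^ i | i :: nat. i \<in> UNIV}"
    using K.finite_field_mult_group_has_gen by (simp add: pow c Compl_eq_Diff_UNIV)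
  then obtain a :: 'k where a: "a \<noteq> 0" "- {0} = {a ^ i | i :: nat. i \<in> UNIV}" by auto
  have "\<exists>i. x = a ^ i" if "x \<noteq> 0" for x :: 'k
  proof -
    have "x \<in> - {0}" using that by simp
    then show ?thesis unfolding a(2) by auto
  qed
  with a(1) show ?thesis by blast
qed

text \<open>
  Characters separate points: in terms of a generator \<open>a\<close>, the character that sends \<open>a\<close> to a
  suitable \<open>(q-1)\<close>-th root of unity is non-trivial at \<open>x = a\<^bsup>e\<^esup>\<close>.
\<close>

lemma ex_mult_char_neq_1:
  fixes x :: "'k::finite_field"
  assumes x: "x \<noteq> 0" "x \<noteq> 1"
  shows "\<exists>\<nu>\<in>mult_chars. \<nu> x \<noteq> 1"
proof -
  define N where "N = CARD('k) - 1"
  have N: "N > 0" "CARD('k) = Suc N" using card_finite_field_ge_2[where 'k='k] by (auto simp: N_def)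
  obtain a :: 'k where a: "a \<noteq> 0" "\<And>y. y \<noteq> 0 \<Longrightarrow> \<exists>i. y = a ^ i"
    using ex_generator by blast
  have aN: "a ^ N = 1"
    using finite_field_power_card_eq_same[of a] a(1) by (simp add: N)
  have mod: "b ^ (i mod N) = b ^ i" if "b ^ N = 1" for b :: "'b::monoid_mult" and i
  proof -
    have "b ^ i = b ^ (N * (i div N) + i mod N)" by simp
    also have "\<dots> = b ^ (i mod N)" unfolding power_add power_mult that by simp
    finally show ?thesis by simp
  qed
  have "inj_on (\<lambda>i. a ^ i) {..<N}"
  proof (rule eq_card_imp_inj_on)
    have "(\<lambda>i. a ^ i) ` {..<N} = - {0::'k}"
    proof (rule equalityI; rule subsetI)
      fix y :: 'k assume "y \<in> - {0}"
      then have "y \<noteq> 0" by simp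
      then obtain i where "y = a ^ i" using a by blast
      then have "y = a ^ (i mod N)" using mod[OF aN] by simp
      then show "y \<in> (\<lambda>i. a ^ i) ` {..<N}" using N by auto
    qed (use a in auto)
    then show "card ((\<lambda>i. a ^ i) ` {..<N}) = card {..<N}"
      by (simp add: N_def Compl_eq_Diff_UNIV)
  qed simp
  then have inj: "i mod N = j mod N" if "a ^ i = a ^ j" for i j
    by (rule inj_onD) (use that mod[OF aN, of i] mod[OF aN, of j] N in auto)
  obtain e where e: "x = a ^ e" using a x by blast
  have "\<not> N dvd e" using e x aN by (auto simp: power_mult)
  then obtain \<zeta> :: qbar where \<zeta>: "\<zeta> ^ N = 1" "\<zeta> ^ e \<noteq> 1"
    using ex_root_of_unity_power_neq_1 N by blast
  have \<zeta>0: "\<zeta> \<noteq> 0" using \<zeta> N by (auto simp: power_0_left)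
  \<comment> \<open>A discrete logarithm is determined only modulo \<open>N\<close>, which does not affect powers of \<open>\<zeta>\<close>.\<close>
  define dlog where "dlog y = (SOME i. y = a ^ i)" for y
  have dlog: "a ^ dlog y = y" if "y \<noteq> 0" for y
    using someI_ex[OF a(2)[OF that]] by (simp add: dlog_def)
  have cong: "\<zeta> ^ i = \<zeta> ^ j" if "a ^ i = a ^ j" for i j
    using mod[OF \<zeta>(1), of i] mod[OF \<zeta>(1), of j] inj[OF that] by simp
  define \<nu> where "\<nu> y = (if y = 0 then 0 else \<zeta> ^ dlog y)" for y
  have "\<nu> (y * z) = \<nu> y * \<nu> z" if "y \<noteq> 0" "z \<noteq> 0" for y z
    using that cong[of "dlog (y * z)" "dlog y + dlog z"] by (simp add: \<nu>_def power_add dlog)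
  then have "\<nu> \<in> mult_chars" by (auto simp: mult_chars_def \<nu>_def \<zeta>0)
  moreover have "\<nu> x \<noteq> 1" using cong[of "dlog x" e] dlog x e \<zeta> by (simp add: \<nu>_def)
  ultimately show ?thesis by blast
qed

text \<open>
  The sum is invariant under multiplication by \<open>\<mu>(x)\<close> for every character \<open>\<mu>\<close>, and for \<open>x \<noteq> 1\<close> there
  is a \<open>\<mu>\<close> with \<open>\<mu>(x) \<noteq> 1\<close>, so the sum vanishes. The value at \<open>1\<close>, the number of characters, is then obtained by summing over all \<open>x\<close>
  and using the orthogonality relation \<open>sum_mult_char\<close>.
\<close>

lemma sum_over_mult_chars:
  fixes x :: "'k::finite_field"
  assumes x: "x \<noteq> 0"
  shows "(\<Sum>\<nu>\<in>mult_chars. \<nu> x) = (if x = 1 then of_nat CARD('k) - 1 else 0)"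
proof -
  have zero: "(\<Sum>\<nu>\<in>mult_chars. \<nu> y) = 0" if y: "y \<noteq> 0" "y \<noteq> 1" for y :: 'k
  proof -
    obtain \<mu> where \<mu>: "\<mu> \<in> mult_chars" "\<mu> y \<noteq> 1" using ex_mult_char_neq_1[OF y] by (elim bexE)
    have "(\<Sum>\<nu>\<in>mult_chars. \<nu> y) = (\<Sum>\<nu>\<in>mult_chars. (\<mu> * \<nu>) y)"
      by (rule sum.reindex_bij_witness[of _ "\<lambda>\<nu>. \<mu> * \<nu>" "\<lambda>\<nu>. inverse \<mu> * \<nu>"])
        (simp_all only: times_inverse_cancel inverse_times_cancel \<mu> mult_chars_times mult_chars_inverse)
    also have "\<dots> = \<mu> y * (\<Sum>\<nu>\<in>mult_chars. \<nu> y)" by (simp add: sum_distrib_left)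
    finally show ?thesis using \<mu> by (simp add: mult_cancel_right1)
  qed
  have "(\<Sum>\<nu>\<in>mult_chars. \<nu> (1::'k)) = (\<Sum>y\<in>-{0::'k}. if y = 1 then \<Sum>\<nu>\<in>mult_chars. \<nu> (1::'k) else 0)"
    by (subst sum.delta) auto
  also have "\<dots> = (\<Sum>y\<in>-{0::'k}. \<Sum>\<nu>\<in>mult_chars. \<nu> y)"
    by (rule sum.cong) (auto simp: zero)
  also have "\<dots> = (\<Sum>\<nu>\<in>mult_chars. \<Sum>y\<in>-{0::'k}. \<nu> y)" by (rule sum.swap)
  also have "\<dots> = (\<Sum>\<nu>\<in>(mult_chars :: ('k \<Rightarrow> qbar) set). if \<nu> = triv_char then of_nat CARD('k) - 1 else 0)"
    by (rule sum.cong) (auto simp: sum_mult_char)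
  also have "\<dots> = of_nat CARD('k) - 1"
    using finite_mult_chars triv_char_in_mult_chars by (subst sum.delta) auto
  finally show ?thesis using zero x by auto
qed

lemma fourier_inversion:
  fixes f :: "'k::finite_field \<Rightarrow> qbar"
  assumes x: "x \<noteq> 0"
  shows "(of_nat CARD('k) - 1) * f x = (\<Sum>\<nu>\<in>mult_chars. (\<Sum>y\<in>-{0}. f y * inverse \<nu> y) * \<nu> x)"
proof -
  have "(\<Sum>\<nu>\<in>mult_chars. (\<Sum>y\<in>-{0}. f y * inverse \<nu> y) * \<nu> x)
      = (\<Sum>y\<in>-{0}. \<Sum>\<nu>\<in>mult_chars. f y * inverse \<nu> y * \<nu> x)"
    unfolding sum_distrib_right by (rule sum.swap)
  also have "\<dots> = (\<Sum>y\<in>-{0}. f y * (\<Sum>\<nu>\<in>mult_chars. \<nu> (x / y)))"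
    by (auto simp: sum_distrib_left mult_char_divide divide_inverse mult_char_mult mult_char_inverse
        mult_ac intro!: sum.cong)
  also have "\<dots> = (\<Sum>y\<in>-{0}. if y = x then f x * (of_nat CARD('k) - 1) else 0)"
    using x by (intro sum.cong) (auto simp: sum_over_mult_chars)
  also have "\<dots> = (of_nat CARD('k) - 1) * f x" using x by (subst sum.delta) auto
  finally show ?thesis by simp
qed

section \<open>Gauss sums and Jacobi sums\<close>

context
  fixes \<psi> :: "'k::finite_field \<Rightarrow> qbar"
  assumes \<psi>: "nontrivial_add_char \<psi>"
begin

lemma add_char_add: "\<psi> (x + y) = \<psi> x * \<psi> y"
  using \<psi> by (simp add: nontrivial_add_char_def)

lemma add_char_zero: "\<psi> 0 = 1"
  using add_char_add[of 0 0] \<psi> by (simp add: nontrivial_add_char_def)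

lemma add_char_sum: "finite I \<Longrightarrow> \<psi> (\<Sum>i\<in>I. u i) = (\<Prod>i\<in>I. \<psi> (u i))"
  by (induction I rule: finite_induct) (auto simp: add_char_add add_char_zero)

lemma sum_add_char: "(\<Sum>x\<in>-{0}. \<psi> (c * x)) = (if c = 0 then of_nat CARD('k) else 0) - 1"
proof (cases "c = 0")
  case True
  then show ?thesis by (simp add: add_char_zero of_nat_card_units)
next
  case False
  obtain z where z: "\<psi> z \<noteq> 1" using \<psi> by (auto simp: nontrivial_add_char_def)
  have "(\<Sum>x\<in>UNIV. \<psi> x) = (\<Sum>x\<in>UNIV. \<psi> (z + x))"
    by (rule sum.reindex_bij_witness[of _ "\<lambda>x. z + x" "\<lambda>x. x - z"]) auto
  also have "\<dots> = \<psi> z * (\<Sum>x\<in>UNIV. \<psi> x)" by (simp add: add_char_add sum_distrib_left)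
  finally have "(\<Sum>x\<in>UNIV. \<psi> x) = 0" using z by (simp add: mult_cancel_right1)
  moreover have "(\<Sum>x\<in>UNIV. \<psi> x) = \<psi> 0 + (\<Sum>x\<in>-{0}. \<psi> x)"
    by (simp add: sum.remove[of _ 0] Compl_eq_Diff_UNIV)
  ultimately have "(\<Sum>x\<in>-{0}. \<psi> x) = -1" by (simp add: add_char_zero eq_neg_iff_add_eq_0 add.commute)
  then show ?thesis using False sum_nonzero_rescale[OF False, of \<psi>] by simp
qed

lemma gauss_triv_char: "gauss \<psi> triv_char = 1"
proof -
  have "(\<Sum>x\<in>-{0}. \<psi> x * triv_char x) = (\<Sum>x\<in>-{0}. \<psi> (1 * x))"
    by (rule sum.cong) (auto simp: triv_char_def)
  then show ?thesis by (simp only: gauss_def sum_add_char) simp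
qed

text \<open>
  The sum over the units is \<open>0\<close> for non-trivial \<open>\<eta>\<close>; for the trivial character it is \<open>q - 1\<close>, which
  is added to \<open>g(\<epsilon>) = 1\<close>. In this form \<open>g\<degree>\<close>
  appears in the evaluation of Jacobi sums without a case distinction.
\<close>

lemma gauss_circ_eq_gauss_plus_sum:
  assumes "\<eta> \<in> mult_chars"
  shows "gauss_circ \<psi> \<eta> = gauss \<psi> \<eta> + (\<Sum>x\<in>-{0}. \<eta> x)"
  by (auto simp: sum_mult_char[OF assms] gauss_circ_def char_delta_def gauss_triv_char)

text \<open>
  For non-trivial \<open>\<eta>\<close>, substituting \<open>x = t y\<close> in the product of the two Gauss sums leaves \<open>\<eta>(t)\<close> times
  the sum of \<open>\<psi>((t+1)y)\<close> over \<open>y\<close>, which singles out \<open>t = -1\<close>. The factor \<open>q\<close> in \<open>g\<degree>\<close> makes the formula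
  hold for the trivial character too.
\<close>

lemma gauss_times_gauss_circ_inverse:
  assumes \<eta>: "\<eta> \<in> mult_chars"
  shows "gauss \<psi> \<eta> * gauss_circ \<psi> (inverse \<eta>) = of_nat CARD('k) * \<eta> (-1)"
proof (cases "\<eta> = triv_char")
  case True
  then show ?thesis
    by (simp add: inverse_triv_char gauss_circ_def char_delta_def gauss_triv_char triv_char_def)
next
  case False
  have "gauss \<psi> \<eta> * gauss_circ \<psi> (inverse \<eta>)
      = (\<Sum>x\<in>-{0}. \<psi> x * \<eta> x) * (\<Sum>y\<in>-{0}. \<psi> y * inverse \<eta> y)"
    using False by (simp add: gauss_circ_def char_delta_def inverse_eq_triv_char_iff gauss_def)
  also have "\<dots> = (\<Sum>y\<in>-{0}. \<Sum>x\<in>-{0}. (\<psi> x * \<eta> x) * (\<psi> y * inverse \<eta> y))"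
    unfolding sum_product by (rule sum.swap)
  also have "\<dots> = (\<Sum>y\<in>-{0}. \<Sum>t\<in>-{0}. \<eta> t * \<psi> ((t + 1) * y))"
  proof (rule sum.cong)
    fix y :: 'k assume y: "y \<in> -{0}"
    have "(\<Sum>x\<in>-{0}. (\<psi> x * \<eta> x) * (\<psi> y * inverse \<eta> y))
        = (\<Sum>t\<in>-{0}. (\<psi> (y * t) * \<eta> (y * t)) * (\<psi> y * inverse \<eta> y))"
      using sum_nonzero_rescale[of y "\<lambda>x. (\<psi> x * \<eta> x) * (\<psi> y * inverse \<eta> y)"] y by simp
    also have "\<dots> = (\<Sum>t\<in>-{0}. \<eta> t * \<psi> ((t + 1) * y))"
      using mult_char_nonzero[OF \<eta>] y
      by (intro sum.cong)
        (auto simp: mult_char_mult[OF \<eta>] distrib_right add_char_add field_simps)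
    finally show "(\<Sum>x\<in>-{0}. (\<psi> x * \<eta> x) * (\<psi> y * inverse \<eta> y)) = \<dots>" .
  qed simp
  also have "\<dots> = (\<Sum>t\<in>-{0}. \<eta> t * (\<Sum>y\<in>-{0}. \<psi> ((t + 1) * y)))"
    unfolding sum_distrib_left by (rule sum.swap)
  also have "\<dots> = (\<Sum>t\<in>-{0}. (if t = -1 then of_nat CARD('k) * \<eta> (-1) else 0) - \<eta> t)"
    unfolding sum_add_char by (rule sum.cong) (auto simp: algebra_simps add_eq_0_iff2)
  also have "\<dots> = of_nat CARD('k) * \<eta> (-1)"
    by (subst sum_subtractf, subst sum.delta) (auto simp: sum_mult_char[OF \<eta>] False)
  finally show ?thesis .
qed

lemma gauss_neq_0: "\<eta> \<in> mult_chars \<Longrightarrow> gauss \<psi> \<eta> \<noteq> 0"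
  using gauss_times_gauss_circ_inverse[of \<eta>] mult_char_nonzero[of \<eta> "-1"] of_nat_card_neq_0
  by auto

lemma gauss_circ_neq_0: "\<eta> \<in> mult_chars \<Longrightarrow> gauss_circ \<psi> \<eta> \<noteq> 0"
  by (simp add: gauss_circ_def gauss_neq_0)

lemma gauss_circ_inverse:
  assumes "\<eta> \<in> mult_chars"
  shows "gauss_circ \<psi> (inverse \<eta>) = of_nat CARD('k) * \<eta> (-1) / gauss \<psi> \<eta>"
  using gauss_times_gauss_circ_inverse[OF assms] gauss_neq_0[OF assms]
  by (simp add: nonzero_eq_divide_eq mult.commute)

lemma gauss_inverse:
  assumes "\<eta> \<in> mult_chars"
  shows "gauss \<psi> (inverse \<eta>) = of_nat CARD('k) * \<eta> (-1) / gauss_circ \<psi> \<eta>"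
proof -
  have "inverse (\<eta> (-1)) = \<eta> (-1)"
    using mult_char_minus_one_square[OF assms] by (rule inverse_unique)
  then show ?thesis
    using gauss_times_gauss_circ_inverse[OF mult_chars_inverse[OF assms]] gauss_circ_neq_0[OF assms]
    by (simp add: nonzero_eq_divide_eq inverse_inverse_fun)
qed

text \<open>
  Let \<open>S(t)\<close> be the same sum with \<open>\<delta>(t - u\<^sub>1 - \<dots> - u\<^sub>n)\<close> as last factor, and \<open>\<eta>\<close> the product of all
  the characters. The sum of \<open>\<psi>(t) S(t)\<close> over all \<open>t\<close> factors into Gauss sums. On the other hand
  \<open>S(t) = \<eta>(t) S(1)\<close> for \<open>t \<noteq> 0\<close>, and \<open>S(0)\<close> is minus the sum of the other values since the sum of
  \<open>S\<close> over all \<open>t\<close> contains the sum of the non-trivial character \<open>\<delta>\<close> as a factor. Thus the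
  same sum is \<open>-g\<degree>(\<eta>) S(1)\<close>.
\<close>

lemma jacobi_sum:
  assumes I: "finite I" and \<chi>: "\<And>i. i \<in> I \<Longrightarrow> \<chi> i \<in> mult_chars"
    and \<delta>: "\<delta> \<in> mult_chars" "\<delta> \<noteq> triv_char"
  shows "(\<Sum>u \<in> I \<rightarrow>\<^sub>E (-{0}). (\<Prod>i\<in>I. \<chi> i (u i)) * \<delta> (1 - (\<Sum>i\<in>I. u i)))
           * gauss_circ \<psi> (\<delta> * (\<Prod>i\<in>I. \<chi> i))
         = (-1) ^ card I * (\<Prod>i\<in>I. gauss \<psi> (\<chi> i)) * gauss \<psi> \<delta>"
proof -
  define U where "U = I \<rightarrow>\<^sub>E (-{0::'k})"
  define S where "S t = (\<Sum>u\<in>U. (\<Prod>i\<in>I. \<chi> i (u i)) * \<delta> (t - (\<Sum>i\<in>I. u i)))" for t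
  define \<eta> where "\<eta> = \<delta> * (\<Prod>i\<in>I. \<chi> i)"
  have \<eta>: "\<eta> \<in> mult_chars" unfolding \<eta>_def by (rule mult_chars_times_prod) (use assms in auto)
  have shift: "(\<Sum>t\<in>UNIV. f t * \<delta> (t - s)) = (\<Sum>v\<in>-{0}. f (v + s) * \<delta> v)" for f and s :: 'k
  proof -
    have "(\<Sum>t\<in>UNIV. f t * \<delta> (t - s)) = (\<Sum>v\<in>UNIV. f (v + s) * \<delta> v)"
      by (rule sum.reindex_bij_witness[of _ "\<lambda>v. v + s" "\<lambda>t. t - s"]) auto
    also have "\<dots> = (\<Sum>v\<in>-{0}. f (v + s) * \<delta> v)"
      by (rule sum.mono_neutral_right) (auto simp: mult_char_zero[OF \<delta>(1)])
    finally show ?thesis .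
  qed
  have homogeneous: "S t = \<eta> t * S 1" if t: "t \<noteq> 0" for t
  proof -
    have "S t = (\<Sum>u\<in>U. (\<Prod>i\<in>I. \<chi> i (t * u i)) * \<delta> (t - (\<Sum>i\<in>I. t * u i)))"
      unfolding S_def
      by (rule sum.reindex_bij_witness[of _ "\<lambda>u. restrict (\<lambda>i. t * u i) I" "\<lambda>u. restrict (\<lambda>i. u i / t) I"])
        (use t in \<open>auto simp: U_def PiE_iff extensional_def fun_eq_iff\<close>)
    also have "\<dots> = (\<Sum>u\<in>U. \<eta> t * ((\<Prod>i\<in>I. \<chi> i (u i)) * \<delta> (1 - (\<Sum>i\<in>I. u i))))"
    proof (rule sum.cong)
      fix u
      have "(\<Prod>i\<in>I. \<chi> i (t * u i)) = (\<Prod>i\<in>I. \<chi> i t) * (\<Prod>i\<in>I. \<chi> i (u i))"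
        unfolding prod.distrib[symmetric] by (rule prod.cong) (auto simp: mult_char_mult \<chi>)
      moreover have "t - (\<Sum>i\<in>I. t * u i) = t * (1 - (\<Sum>i\<in>I. u i))"
        by (simp add: sum_distrib_left algebra_simps)
      ultimately show "(\<Prod>i\<in>I. \<chi> i (t * u i)) * \<delta> (t - (\<Sum>i\<in>I. t * u i))
          = \<eta> t * ((\<Prod>i\<in>I. \<chi> i (u i)) * \<delta> (1 - (\<Sum>i\<in>I. u i)))"
        by (simp add: \<eta>_def mult_char_mult[OF \<delta>(1)] prod_fun_apply)
    qed simp
    finally show ?thesis by (simp add: S_def sum_distrib_left)
  qed
  have "(\<Sum>t\<in>UNIV. S t) = (\<Sum>u\<in>U. \<Sum>t\<in>UNIV. (\<Prod>i\<in>I. \<chi> i (u i)) * \<delta> (t - (\<Sum>i\<in>I. u i)))"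
    unfolding S_def by (rule sum.swap)
  also have "\<dots> = 0"
    unfolding shift by (simp add: sum_distrib_left[symmetric] sum_mult_char \<delta>)
  finally have "S 0 + (\<Sum>t\<in>-{0}. S t) = 0"
    by (simp add: sum.remove[of _ 0] Compl_eq_Diff_UNIV)
  then have "S 0 = - (\<Sum>t\<in>-{0}. S t)" by (simp only: eq_neg_iff_add_eq_0)
  also have "(\<Sum>t\<in>-{0}. S t) = (\<Sum>t\<in>-{0}. \<eta> t * S 1)"
    by (rule sum.cong) (auto intro: homogeneous)
  finally have S0: "S 0 = - (\<Sum>t\<in>-{0}. \<eta> t) * S 1" by (simp add: sum_distrib_right)
  have "(\<Sum>t\<in>UNIV. \<psi> t * S t) = S 0 + (\<Sum>t\<in>-{0}. \<psi> t * S t)"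
    by (simp add: sum.remove[of _ 0] Compl_eq_Diff_UNIV add_char_zero)
  also have "(\<Sum>t\<in>-{0}. \<psi> t * S t) = (\<Sum>t\<in>-{0}. \<psi> t * \<eta> t) * S 1"
    unfolding sum_distrib_right by (rule sum.cong) (auto intro: homogeneous)
  also have "S 0 + \<dots> = - gauss_circ \<psi> \<eta> * S 1"
    by (simp add: S0 gauss_circ_eq_gauss_plus_sum[OF \<eta>] gauss_def algebra_simps)
  finally have left: "(\<Sum>t\<in>UNIV. \<psi> t * S t) = - gauss_circ \<psi> \<eta> * S 1" .
  have "(\<Sum>t\<in>UNIV. \<psi> t * S t)
      = (\<Sum>u\<in>U. \<Sum>t\<in>UNIV. (\<psi> t * (\<Prod>i\<in>I. \<chi> i (u i))) * \<delta> (t - (\<Sum>i\<in>I. u i)))"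
    unfolding S_def sum_distrib_left mult.assoc by (rule sum.swap)
  also have "\<dots> = (\<Sum>u\<in>U. (\<Prod>i\<in>I. \<psi> (u i) * \<chi> i (u i)) * (\<Sum>v\<in>-{0}. \<psi> v * \<delta> v))"
    unfolding shift
    by (simp add: add_char_add add_char_sum I prod.distrib sum_distrib_left mult_ac)
  also have "\<dots> = (\<Prod>i\<in>I. \<Sum>x\<in>-{0}. \<psi> x * \<chi> i x) * (\<Sum>v\<in>-{0}. \<psi> v * \<delta> v)"
    by (simp add: prod_sum_PiE I U_def sum_distrib_right)
  also have "\<dots> = - ((-1) ^ card I * (\<Prod>i\<in>I. gauss \<psi> (\<chi> i)) * gauss \<psi> \<delta>)"
    by (simp add: gauss_def prod_uminus mult.assoc)
  finally show ?thesis using left by (simp add: S_def U_def \<eta>_def mult.commute)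
qed

lemma binary_jacobi_sum:
  assumes \<chi>: "\<chi> \<in> mult_chars" and \<delta>: "\<delta> \<in> mult_chars" "\<delta> \<noteq> triv_char"
  shows "(\<Sum>y\<in>-{0}. \<delta> (1 - y) * \<chi> y) * gauss_circ \<psi> (\<delta> * \<chi>) = - gauss \<psi> \<delta> * gauss \<psi> \<chi>"
proof -
  have "(\<Sum>y\<in>-{0}. \<delta> (1 - y) * \<chi> y) = (\<Sum>u \<in> {()} \<rightarrow>\<^sub>E (-{0}). \<chi> (u ()) * \<delta> (1 - u ()))"
    by (rule sum.reindex_bij_witness[of _ "\<lambda>u. u ()" "\<lambda>y _. y"])
      (auto simp: PiE_iff extensional_def fun_eq_iff)
  then show ?thesis using jacobi_sum[of "{()}" "\<lambda>_. \<chi>" \<delta>] assms by simp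
qed

text \<open>
  Fourier inversion for \<open>y \<mapsto> \<beta>\<inverse>(1 - y)\<close>. Non-triviality of \<open>\<beta>\<close> is what allows the coefficients to be
  evaluated by \<open>binary_jacobi_sum\<close>, with \<open>\<beta>\<inverse>\<close> as the distinguished character; reflection then turns
  the Gauss sums of inverse characters into those of \<open>\<beta>\<close>, \<open>\<nu>\<close> and \<open>\<beta>\<nu>\<close>.
\<close>

lemma binomial_expansion:
  assumes \<beta>: "\<beta> \<in> mult_chars" "\<beta> \<noteq> triv_char" and x: "x \<noteq> 0"
  shows "inverse \<beta> (1 - x)
       = 1 / (1 - of_nat CARD('k)) * (\<Sum>\<nu>\<in>mult_chars. poch \<psi> \<beta> \<nu> / poch_circ \<psi> triv_char \<nu> * \<nu> x)"
proof -
  define q :: qbar where "q = of_nat CARD('k)"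
  have q: "q \<noteq> 0" "q \<noteq> 1" unfolding q_def by (rule of_nat_card_neq_0, rule of_nat_card_neq_1)
  have coeff: "(\<Sum>y\<in>-{0}. inverse \<beta> (1 - y) * inverse \<nu> y)
      = - (poch \<psi> \<beta> \<nu> / poch_circ \<psi> triv_char \<nu>)" (is "?c = _") if \<nu>: "\<nu> \<in> mult_chars" for \<nu>
  proof -
    have \<beta>\<nu>: "\<beta> * \<nu> \<in> mult_chars" by (intro mult_chars_times \<beta> \<nu>)
    have nz: "gauss \<psi> \<beta> \<noteq> 0" "gauss_circ \<psi> \<nu> \<noteq> 0" "gauss \<psi> (\<beta> * \<nu>) \<noteq> 0" "\<beta> (-1) \<noteq> 0" "\<nu> (-1) \<noteq> 0"
      using \<beta> \<nu> \<beta>\<nu> by (auto simp: gauss_neq_0 gauss_circ_neq_0 mult_char_nonzero)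
    have circ: "gauss_circ \<psi> \<beta> = gauss \<psi> \<beta>" "gauss_circ \<psi> triv_char = q"
      using \<beta> by (auto simp: gauss_circ_def char_delta_def gauss_triv_char q_def)
    have "?c * gauss_circ \<psi> (inverse (\<beta> * \<nu>)) = - gauss \<psi> (inverse \<beta>) * gauss \<psi> (inverse \<nu>)"
      using binary_jacobi_sum[of "inverse \<nu>" "inverse \<beta>"] \<beta> \<nu>
      by (simp add: mult_chars_inverse inverse_eq_triv_char_iff inverse_times_fun)
    then have "?c * (q * (\<beta> (-1) * \<nu> (-1)) / gauss \<psi> (\<beta> * \<nu>))
        = - (q * \<beta> (-1) / gauss \<psi> \<beta>) * (q * \<nu> (-1) / gauss_circ \<psi> \<nu>)"
      by (simp add: gauss_circ_inverse[OF \<beta>\<nu>] gauss_inverse \<beta> \<nu> circ q_def)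
    then have "?c * (q * (\<beta> (-1) * \<nu> (-1)) / gauss \<psi> (\<beta> * \<nu>))
        = - (gauss \<psi> (\<beta> * \<nu>) / gauss \<psi> \<beta> / (gauss_circ \<psi> \<nu> / q))
          * (q * (\<beta> (-1) * \<nu> (-1)) / gauss \<psi> (\<beta> * \<nu>))"
      using nz q by (simp del: times_fun_apply)
    moreover have "q * (\<beta> (-1) * \<nu> (-1)) / gauss \<psi> (\<beta> * \<nu>) \<noteq> 0"
      using nz q by simp
    ultimately have "?c = - (gauss \<psi> (\<beta> * \<nu>) / gauss \<psi> \<beta> / (gauss_circ \<psi> \<nu> / q))"
      by (rule mult_right_cancel[THEN iffD1, rotated])
    then show ?thesis by (simp add: poch_def poch_circ_def triv_char_times \<nu> circ)
  qed
  have "(q - 1) * inverse \<beta> (1 - x)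
      = - (\<Sum>\<nu>\<in>mult_chars. poch \<psi> \<beta> \<nu> / poch_circ \<psi> triv_char \<nu> * \<nu> x)"
    unfolding q_def fourier_inversion[OF x, of "\<lambda>y. inverse \<beta> (1 - y)"]
    by (simp add: coeff sum_negf[symmetric] del: inverse_fun_apply cong: sum.cong)
  moreover have "(1 - q) * inverse \<beta> (1 - x) = - ((q - 1) * inverse \<beta> (1 - x))"
    by (simp add: left_diff_distrib)
  ultimately have "(1 - q) * inverse \<beta> (1 - x)
      = (\<Sum>\<nu>\<in>mult_chars. poch \<psi> \<beta> \<nu> / poch_circ \<psi> triv_char \<nu> * \<nu> x)"
    by (simp only: minus_minus)
  then show ?thesis using q by (simp add: q_def[symmetric] eq_divide_eq mult.commute)
qed

lemma gauss_inverse_times: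
  assumes "\<gamma> \<in> mult_chars" "\<nu> \<in> mult_chars"
  shows "gauss \<psi> (inverse (\<gamma> * \<nu>)) = gauss \<psi> (inverse \<gamma>) * \<nu> (-1) / poch_circ \<psi> \<gamma> \<nu>"
  using assms gauss_circ_neq_0[of \<gamma>] gauss_circ_neq_0[of "\<gamma> * \<nu>"]
  by (simp add: gauss_inverse mult_chars_times poch_circ_def)

lemma gauss_circ_inverse_times:
  assumes "\<alpha> \<in> mult_chars" "\<nu> \<in> mult_chars"
  shows "gauss_circ \<psi> (inverse (\<alpha> * \<nu>)) = gauss_circ \<psi> (inverse \<alpha>) * \<nu> (-1) / poch \<psi> \<alpha> \<nu>"
  using assms gauss_neq_0[of \<alpha>] gauss_neq_0[of "\<alpha> * \<nu>"]
  by (simp add: gauss_circ_inverse mult_chars_times poch_def)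

text \<open>
  The inner sum of the expanded right-hand side. The product of all its characters is \<open>(\<alpha>\<mu>)\<inverse>\<close>, where
  \<open>\<mu>\<close> is the product of the \<open>\<nu>\<^sub>i\<close>, because the \<open>\<gamma>\<^sub>i\<close> cancel against \<open>\<delta>\<close>. Reflection contributes the
  sign \<open>\<nu>\<^sub>i(-1)\<close> for each \<open>i\<close> in the numerator and \<open>\<mu>(-1)\<close> in the denominator. For an empty index set
  \<open>\<mu>\<close> would be the constant function \<open>1\<close>, which is not a character.
\<close>

lemma twisted_jacobi_sum:
  assumes I: "finite I" "I \<noteq> {}" and \<alpha>: "\<alpha> \<in> mult_chars"
    and \<gamma>: "\<And>i. i \<in> I \<Longrightarrow> \<gamma> i \<in> mult_chars" and \<nu>: "\<And>i. i \<in> I \<Longrightarrow> \<nu> i \<in> mult_chars"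
    and \<delta>: "inverse \<alpha> * (\<Prod>i\<in>I. \<gamma> i) \<noteq> triv_char"
  shows "(\<Sum>u \<in> I \<rightarrow>\<^sub>E (-{0}). (\<Prod>i\<in>I. inverse (\<gamma> i * \<nu> i) (u i)) *
             (inverse \<alpha> * (\<Prod>i\<in>I. \<gamma> i)) (1 - (\<Sum>i\<in>I. u i)))
       = (-1) ^ card I * ((\<Prod>i\<in>I. gauss \<psi> (inverse (\<gamma> i))) * gauss \<psi> (inverse \<alpha> * (\<Prod>i\<in>I. \<gamma> i))
             / gauss_circ \<psi> (inverse \<alpha>))
         * (poch \<psi> \<alpha> (\<Prod>i\<in>I. \<nu> i) / (\<Prod>i\<in>I. poch_circ \<psi> (\<gamma> i) (\<nu> i)))"
    (is "?J = _")
proof -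
  define \<delta>' where "\<delta>' = inverse \<alpha> * (\<Prod>i\<in>I. \<gamma> i)"
  define \<mu> where "\<mu> = (\<Prod>i\<in>I. \<nu> i)"
  have \<mu>: "\<mu> \<in> mult_chars" unfolding \<mu>_def by (rule mult_chars_prod) (use I \<nu> in auto)
  have \<gamma>p: "(\<Prod>i\<in>I. \<gamma> i) \<in> mult_chars" by (rule mult_chars_prod) (use I \<gamma> in auto)
  have \<delta>': "\<delta>' \<in> mult_chars" "\<delta>' \<noteq> triv_char"
    unfolding \<delta>'_def using \<delta> by (auto intro!: mult_chars_times mult_chars_inverse \<alpha> \<gamma>p)
  have total: "\<delta>' * (\<Prod>i\<in>I. inverse (\<gamma> i * \<nu> i)) = inverse (\<alpha> * \<mu>)"
  proof -
    have "\<delta>' * (\<Prod>i\<in>I. inverse (\<gamma> i * \<nu> i))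
        = (\<Prod>i\<in>I. \<gamma> i) * (inverse (\<Prod>i\<in>I. \<gamma> i) * (inverse \<alpha> * inverse \<mu>))"
      by (simp add: \<delta>'_def \<mu>_def inverse_times_fun prod.distrib inverse_prod_fun mult_ac)
    also have "\<dots> = inverse (\<alpha> * \<mu>)"
      by (simp add: times_inverse_cancel \<gamma>p mult_chars_times mult_chars_inverse \<alpha> \<mu> inverse_times_fun)
    finally show ?thesis .
  qed
  have "?J * gauss_circ \<psi> (inverse (\<alpha> * \<mu>))
      = (-1) ^ card I * (\<Prod>i\<in>I. gauss \<psi> (inverse (\<gamma> i * \<nu> i))) * gauss \<psi> \<delta>'"
    unfolding \<delta>'_def[symmetric] total[symmetric]
    by (rule jacobi_sum) (intro mult_chars_inverse mult_chars_times I \<gamma> \<nu> \<delta>'; assumption)+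
  also have "(\<Prod>i\<in>I. gauss \<psi> (inverse (\<gamma> i * \<nu> i)))
      = (\<Prod>i\<in>I. gauss \<psi> (inverse (\<gamma> i))) * \<mu> (-1) / (\<Prod>i\<in>I. poch_circ \<psi> (\<gamma> i) (\<nu> i))"
  proof -
    have "(\<Prod>i\<in>I. gauss \<psi> (inverse (\<gamma> i * \<nu> i)))
        = (\<Prod>i\<in>I. gauss \<psi> (inverse (\<gamma> i)) * \<nu> i (-1) / poch_circ \<psi> (\<gamma> i) (\<nu> i))"
      by (intro prod.cong refl gauss_inverse_times \<gamma> \<nu>)
    then show ?thesis by (simp only: prod.distrib prod_dividef \<mu>_def prod_fun_apply)
  qed
  also have "gauss_circ \<psi> (inverse (\<alpha> * \<mu>)) = gauss_circ \<psi> (inverse \<alpha>) * \<mu> (-1) / poch \<psi> \<alpha> \<mu>"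
    by (rule gauss_circ_inverse_times[OF \<alpha> \<mu>])
  finally have eq: "?J * (gauss_circ \<psi> (inverse \<alpha>) * \<mu> (-1) / poch \<psi> \<alpha> \<mu>)
      = (-1) ^ card I * ((\<Prod>i\<in>I. gauss \<psi> (inverse (\<gamma> i))) * \<mu> (-1)
          / (\<Prod>i\<in>I. poch_circ \<psi> (\<gamma> i) (\<nu> i))) * gauss \<psi> \<delta>'" .
  define g where "g = gauss_circ \<psi> (inverse \<alpha>)"
  define P where "P = (\<Prod>i\<in>I. gauss \<psi> (inverse (\<gamma> i)))"
  define Q where "Q = (\<Prod>i\<in>I. poch_circ \<psi> (\<gamma> i) (\<nu> i))"
  have nz: "\<mu> (-1) \<noteq> 0" "g \<noteq> 0" "poch \<psi> \<alpha> \<mu> \<noteq> 0"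
    using \<mu> \<alpha> by (auto simp: mult_char_nonzero gauss_circ_neq_0 mult_chars_inverse poch_def
        gauss_neq_0 mult_chars_times g_def)
  \<comment> \<open>Both sides of the claim agree after multiplication by a common non-zero factor, in which the
    two occurrences of \<open>\<mu>(-1)\<close> meet.\<close>
  have "(-1) ^ card I * (P * gauss \<psi> \<delta>' / g) * (poch \<psi> \<alpha> \<mu> / Q) * (g * \<mu> (-1) / poch \<psi> \<alpha> \<mu>)
      = (-1) ^ card I * (P * \<mu> (-1) / Q) * gauss \<psi> \<delta>'"
    using nz by simp
  also have "\<dots> = ?J * (g * \<mu> (-1) / poch \<psi> \<alpha> \<mu>)"
    using eq unfolding g_def P_def Q_def by (rule sym)
  finally have scaled: "(-1) ^ card I * (P * gauss \<psi> \<delta>' / g) * (poch \<psi> \<alpha> \<mu> / Q)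
      * (g * \<mu> (-1) / poch \<psi> \<alpha> \<mu>) = ?J * (g * \<mu> (-1) / poch \<psi> \<alpha> \<mu>)" .
  have "g * \<mu> (-1) / poch \<psi> \<alpha> \<mu> \<noteq> 0" using nz by simp
  from mult_right_cancel[OF this, THEN iffD1, OF scaled[symmetric]]
  have "?J = (-1) ^ card I * (P * gauss \<psi> \<delta>' / g) * (poch \<psi> \<alpha> \<mu> / Q)" .
  then show ?thesis unfolding g_def P_def Q_def \<delta>'_def \<mu>_def .
qed

end

section \<open>The Lauricella function as a character sum\<close>

theorem theorem3p4:
  fixes \<psi> :: "'k::finite_field \<Rightarrow> qbar"
    and n :: nat
    and \<alpha> :: "'k \<Rightarrow> qbar"
    and \<beta> \<gamma> :: "nat \<Rightarrow> 'k \<Rightarrow> qbar"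
    and l :: "nat \<Rightarrow> 'k"
  assumes "nontrivial_add_char \<psi>"
    and "n \<ge> 1"
    and "\<alpha> \<in> mult_chars"
    and "\<forall>i\<in>{1..n}. \<beta> i \<in> mult_chars"
    and "\<forall>i\<in>{1..n}. \<gamma> i \<in> mult_chars"
    and "inverse \<alpha> * (\<Prod>i=1..n. \<gamma> i) \<noteq> triv_char"
    and "\<forall>i\<in>{1..n}. \<beta> i \<noteq> triv_char"
    and "\<forall>i\<in>{1..n}. l i \<noteq> 0"
  shows "(-1) ^ n *
           ((\<Prod>i=1..n. gauss \<psi> (inverse (\<gamma> i))) * gauss \<psi> (inverse \<alpha> * (\<Prod>i=1..n. \<gamma> i))
              / gauss_circ \<psi> (inverse \<alpha>)) *
           lauricella_FA \<psi> n \<alpha> \<beta> \<gamma> l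
         = (\<Sum>u \<in> {1..n} \<rightarrow>\<^sub>E (- {0}).
              (\<Prod>i=1..n. inverse (\<beta> i) (1 - l i / u i)) *
              (\<Prod>i=1..n. inverse (\<gamma> i) (u i)) *
              (inverse \<alpha> * (\<Prod>i=1..n. \<gamma> i)) (1 - (\<Sum>i=1..n. u i)))"
proof -
  define c :: qbar where "c = 1 / (1 - of_nat CARD('k))"
  define \<delta> where "\<delta> = inverse \<alpha> * (\<Prod>i=1..n. \<gamma> i)"
  define C where "C = (-1) ^ n *
    ((\<Prod>i=1..n. gauss \<psi> (inverse (\<gamma> i))) * gauss \<psi> \<delta> / gauss_circ \<psi> (inverse \<alpha>))"
  define b where "b i \<nu> = poch \<psi> (\<beta> i) \<nu> / poch_circ \<psi> triv_char \<nu> * \<nu> (l i)" for i \<nu>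
  define U where "U = {1..n} \<rightarrow>\<^sub>E (- {0 :: 'k})"
  define V where "V = {1..n} \<rightarrow>\<^sub>E (mult_chars :: ('k \<Rightarrow> qbar) set)"
  have expand: "(\<Prod>i=1..n. inverse (\<beta> i) (1 - l i / u i))
      = c ^ n * (\<Sum>\<nu>\<in>V. \<Prod>i=1..n. b i (\<nu> i) * inverse (\<nu> i) (u i))" if u: "u \<in> U" for u
  proof -
    have "inverse (\<beta> i) (1 - l i / u i) = c * (\<Sum>\<nu>\<in>mult_chars. b i \<nu> * inverse \<nu> (u i))"
      if i: "i \<in> {1..n}" for i
    proof -
      have "l i / u i \<noteq> 0" using assms(8) u i by (auto simp: U_def PiE_iff)
      then show ?thesis
        unfolding c_def using assms i
        by (subst binomial_expansion[OF assms(1)])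
          (auto simp: b_def divide_inverse mult_char_mult mult_char_inverse mult_ac intro!: sum.cong)
    qed
    then have "(\<Prod>i=1..n. inverse (\<beta> i) (1 - l i / u i))
        = (\<Prod>i=1..n. c * (\<Sum>\<nu>\<in>mult_chars. b i \<nu> * inverse \<nu> (u i)))"
      by (intro prod.cong) auto
    then show ?thesis
      by (simp add: prod.distrib V_def prod_sum_PiE finite_mult_chars)
  qed
  have "(\<Sum>u\<in>U. (\<Prod>i=1..n. inverse (\<beta> i) (1 - l i / u i)) * (\<Prod>i=1..n. inverse (\<gamma> i) (u i)) *
            \<delta> (1 - (\<Sum>i=1..n. u i)))
      = (\<Sum>u\<in>U. \<Sum>\<nu>\<in>V. c ^ n * (\<Prod>i=1..n. b i (\<nu> i)) *
            ((\<Prod>i=1..n. inverse (\<gamma> i * \<nu> i) (u i)) * \<delta> (1 - (\<Sum>i=1..n. u i))))"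
    by (intro sum.cong refl, subst expand)
      (simp_all add: sum_distrib_left sum_distrib_right prod.distrib mult_ac)
  also have "\<dots> = (\<Sum>\<nu>\<in>V. c ^ n * (\<Prod>i=1..n. b i (\<nu> i)) *
            (\<Sum>u\<in>U. (\<Prod>i=1..n. inverse (\<gamma> i * \<nu> i) (u i)) * \<delta> (1 - (\<Sum>i=1..n. u i))))"
    unfolding sum_distrib_left by (rule sum.swap)
  also have "\<dots> = (\<Sum>\<nu>\<in>V. c ^ n * (\<Prod>i=1..n. b i (\<nu> i)) *
            (C * (poch \<psi> \<alpha> (\<Prod>i=1..n. \<nu> i) / (\<Prod>i=1..n. poch_circ \<psi> (\<gamma> i) (\<nu> i)))))"
  proof (intro sum.cong refl arg_cong2[where f="(*)"])
    fix \<nu> assume "\<nu> \<in> V"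
    then have "\<nu> i \<in> mult_chars" if "i \<in> {1..n}" for i using that by (auto simp: V_def)
    then show "(\<Sum>u\<in>U. (\<Prod>i=1..n. inverse (\<gamma> i * \<nu> i) (u i)) * \<delta> (1 - (\<Sum>i=1..n. u i)))
        = C * (poch \<psi> \<alpha> (\<Prod>i=1..n. \<nu> i) / (\<Prod>i=1..n. poch_circ \<psi> (\<gamma> i) (\<nu> i)))"
      using twisted_jacobi_sum[OF assms(1), of "{1..n}" \<alpha> \<gamma> \<nu>] assms(2,3,5,6)
      by (simp add: U_def \<delta>_def C_def del: inverse_fun_apply times_fun_apply)
  qed
  also have "\<dots> = C * lauricella_FA \<psi> n \<alpha> \<beta> \<gamma> l"
    unfolding lauricella_FA_def sum_distrib_left V_def b_def c_def
    by (intro sum.cong refl) (simp add: prod.distrib prod_dividef power_one_over mult_ac)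
  finally show ?thesis by (simp only: C_def \<delta>_def U_def)
qed

end
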